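(* Let $H$ be a complex Hilbert space and let $A,B\in B(H)$ be such that $AB=BA$. If $A$ is normal and $B$ is hyponormal, then $|A-B|\leq |A|+|B|$.
   Context: $B(H)$ denotes the algebra of bounded linear operators on $H$. An operator $T\in B(H)$ is positive, $T\geq 0$, if $\langle Tx,x\rangle\geq 0$ for all $x\in H$; for self-adjoint $S,T$, $S\leq T$ means $T-S\geq 0$. For $T\in B(H)$, $|T|=\sqrt{T^*T}$ denotes the absolute value (modulus) of $T$, i.e. the unique positive square root of $T^*T$. An operator $T$ is normal if $TT^*=T^*T$, and hyponormal if $TT^*\leq T^*T$, equivalently $\|T^*x\|\leq\|Tx\|$ for all $x\in H$. *)

theory Defs
  imports "HOL-Analysis.Analysis"
begin

text \<open>
  A complex inner product space is rendered as a real inner product space (whose norm, metric and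
  topology it inherits) together with a multiplication by complex scalars extending the real one
  and a complex inner product, linear in its first argument, whose real part is the real inner
  product. Positive definiteness is inherited: \<open>cinner x x\<close> is real by \<open>cinner_commute\<close> and
  its real part is \<open>inner x x = (norm x)\<^sup>2\<close>. Every complex inner product space carries this
  structure in exactly one way.
\<close>

class complex_inner_space = real_inner +
  fixes scaleC :: "complex \<Rightarrow> 'a \<Rightarrow> 'a" (infixr \<open>*\<^sub>C\<close> 75)
    and cinner :: "'a \<Rightarrow> 'a \<Rightarrow> complex"
  assumes scaleC_add_right: "c *\<^sub>C (x + y) = c *\<^sub>C x + c *\<^sub>C y"
    and scaleC_add_left: "(c + d) *\<^sub>C x = c *\<^sub>C x + d *\<^sub>C x"
    and scaleC_scaleC: "c *\<^sub>C (d *\<^sub>C x) = (c * d) *\<^sub>C x"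
    and scaleC_one: "1 *\<^sub>C x = x"
    and scaleR_scaleC: "r *\<^sub>R x = complex_of_real r *\<^sub>C x"
    and cinner_commute: "cinner x y = cnj (cinner y x)"
    and cinner_add_left: "cinner (x + y) z = cinner x z + cinner y z"
    and cinner_scaleC_left: "cinner (c *\<^sub>C x) y = c * cinner x y"
    and inner_eq_Re_cinner: "inner x y = Re (cinner x y)"

class complex_hilbert_space = complex_inner_space + complete_space

instantiation complex :: complex_hilbert_space
begin

definition scaleC_complex :: "complex \<Rightarrow> complex \<Rightarrow> complex"
  where "scaleC_complex c x = c * x"

definition cinner_complex :: "complex \<Rightarrow> complex \<Rightarrow> complex"
  where "cinner_complex x y = x * cnj y"

instance
  by standard
    (simp_all add: scaleC_complex_def cinner_complex_def algebra_simps scaleR_conv_of_real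
      inner_complex_def)

end

definition bounded_clinear ::
    "('a::complex_inner_space \<Rightarrow> 'b::complex_inner_space) \<Rightarrow> bool"
  where "bounded_clinear T \<longleftrightarrow> bounded_linear T \<and> (\<forall>c x. T (c *\<^sub>C x) = c *\<^sub>C T x)"

text \<open>
  For a bounded operator on a Hilbert space the adjoint exists and is unique among all functions,
  so boundedness and linearity of \<open>S\<close> need not be required.
\<close>

definition cadjoint :: "('a::complex_hilbert_space \<Rightarrow> 'a) \<Rightarrow> 'a \<Rightarrow> 'a"
  where "cadjoint T = (THE S. \<forall>x y. cinner (T x) y = cinner x (S y))"

definition positive_op :: "('a::complex_hilbert_space \<Rightarrow> 'a) \<Rightarrow> bool"
  where "positive_op T \<longleftrightarrow> bounded_clinear T \<and> (\<forall>x. cinner (T x) x \<in> \<real>\<^sub>\<ge>\<^sub>0)"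

text \<open>The following order is meant for self-adjoint \<open>S\<close> and \<open>T\<close>, and only used for such.\<close>

definition op_le :: "('a::complex_hilbert_space \<Rightarrow> 'a) \<Rightarrow> ('a \<Rightarrow> 'a) \<Rightarrow> bool"
  where "op_le S T \<longleftrightarrow> positive_op (\<lambda>x. T x - S x)"

definition op_sqrt :: "('a::complex_hilbert_space \<Rightarrow> 'a) \<Rightarrow> 'a \<Rightarrow> 'a"
  where "op_sqrt T = (THE P. positive_op P \<and> P \<circ> P = T)"

definition op_abs :: "('a::complex_hilbert_space \<Rightarrow> 'a) \<Rightarrow> 'a \<Rightarrow> 'a"
  where "op_abs T = op_sqrt (cadjoint T \<circ> T)"

definition normal_op :: "('a::complex_hilbert_space \<Rightarrow> 'a) \<Rightarrow> bool"
  where "normal_op T \<longleftrightarrow> T \<circ> cadjoint T = cadjoint T \<circ> T"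

definition hyponormal_op :: "('a::complex_hilbert_space \<Rightarrow> 'a) \<Rightarrow> bool"
  where "hyponormal_op T \<longleftrightarrow> op_le (T \<circ> cadjoint T) (cadjoint T \<circ> T)"

end

theory Submission
  imports Defs "HOL-Complex_Analysis.Cauchy_Integral_Formula"
begin

text \<open>
  Two facts carry the proof. The first is Fuglede's theorem (\<open>fuglede\<close>): an operator commuting with
  a normal operator commutes with its adjoint. Hence \<open>A\<close> and \<open>A\<^sup>*\<close> commute with \<open>B\<close> and \<open>B\<^sup>*\<close>, and
  \<open>|A|\<close> commutes with \<open>B\<close>, \<open>B\<^sup>*\<close> and \<open>|B|\<close>; in particular \<open>|A| |B|\<close> is positive. The second is
  monotonicity of the square root in the form of \<open>norm_le_imp_inner_le\<close>: if \<open>S\<close> is symmetric,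
  \<open>T\<close> is positive and \<open>\<parallel>S x\<parallel> \<le> \<parallel>T x\<parallel>\<close> for all \<open>x\<close>, then \<open>S \<le> T\<close>.

  Monotonicity is applied twice. For \<open>X = - (A\<^sup>* B + B\<^sup>* A) / 2\<close> one has
  \<open>\<parallel>A\<^sup>* B x\<parallel> = \<parallel>|A| |B| x\<parallel>\<close> by normality of \<open>A\<close> and
  \<open>\<parallel>B\<^sup>* A x\<parallel> = \<parallel>B\<^sup>* |A| x\<parallel> \<le> \<parallel>B |A| x\<parallel> = \<parallel>|A| |B| x\<parallel>\<close> by hyponormality of \<open>B\<close>. So
  \<open>\<parallel>X x\<parallel> \<le> \<parallel>|A| |B| x\<parallel>\<close>, and therefore \<open>X \<le> |A| |B|\<close>, which says that
  \<open>- Re \<langle>A x, B x\<rangle> \<le> Re \<langle>|A| x, |B| x\<rangle>\<close>. Adding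
  \<open>\<parallel>A x\<parallel>\<^sup>2 + \<parallel>B x\<parallel>\<^sup>2 = \<parallel>|A| x\<parallel>\<^sup>2 + \<parallel>|B| x\<parallel>\<^sup>2\<close> to twice this inequality gives
  \<open>\<parallel>(A - B) x\<parallel> \<le> \<parallel>(|A| + |B|) x\<parallel>\<close>. The left side is the norm of \<open>|A - B| x\<close>, and the second
  application of monotonicity concludes.

  As \<open>op_abs\<close> and \<open>cadjoint\<close> are defined by unique existence, adjoints and positive square roots
  are constructed first. Most arguments use only the real inner product, with multiplication by
  \<open>\<i>\<close> as one more bounded operator.
\<close>

section \<open>Adjoints of bounded operators\<close>

text \<open>
  The representing vector minimises the strictly convex functional \<open>\<parallel>x\<parallel>\<^sup>2 / 2 - f x\<close>: by the
  parallelogram identity every minimising sequence is Cauchy, and at the minimum the derivative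
  \<open>inner x v - f x\<close> in each direction \<open>x\<close> vanishes.
\<close>

lemma riesz_representation:
  fixes f :: "'a::{real_inner, banach} \<Rightarrow> real"
  assumes "bounded_linear f"
  shows "\<exists>v. \<forall>x. f x = inner x v"
proof -
  interpret f: bounded_linear f by fact
  define g where "g x = (norm x)\<^sup>2 / 2 - f x" for x
  obtain K where K: "\<And>x. norm (f x) \<le> norm x * K" using f.bounded by blast
  have below: "- (K\<^sup>2 / 2) \<le> g x" for x
  proof -
    have "f x \<le> norm x * K" using K[of x] by simp
    moreover have "0 \<le> (norm x - K)\<^sup>2" by simp
    ultimately show ?thesis unfolding g_def by (simp add: power2_diff)
  qed
  define m where "m = Inf (range g)"
  have bdd: "bdd_below (range g)" using below by (auto simp: bdd_below_def)
  have m_le: "m \<le> g x" for x unfolding m_def by (rule cInf_lower[OF _ bdd]) simp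
  define e where "e n = inverse (real (Suc n))" for n
  have e0: "e \<longlonglongrightarrow> 0" unfolding e_def by (rule LIMSEQ_inverse_real_of_nat)
  have "\<exists>x. g x < m + e n" for n
    using cInf_lessD[of "range g" "m + e n"] unfolding m_def e_def by auto
  then obtain X where X: "\<And>n. g (X n) < m + e n" by metis
  have parallelogram: "(norm (a - b))\<^sup>2 / 4 = g a + g b - 2 * g ((1/2) *\<^sub>R (a + b))" for a b
    unfolding g_def
    by (simp add: f.add f.scaleR power2_norm_eq_inner inner_add_left inner_add_right
        inner_diff_left inner_diff_right inner_commute[of b a] field_simps)
  have close: "(norm (X i - X j))\<^sup>2 \<le> 4 * (e i + e j)" for i j
    using parallelogram[of "X i" "X j"] X[of i] X[of j] m_le[of "(1/2) *\<^sub>R (X i + X j)"]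
    by argo
  have "Cauchy X"
  proof (rule CauchyI)
    fix r :: real assume r: "0 < r"
    then have "\<forall>\<^sub>F n in sequentially. e n < r\<^sup>2 / 8" using order_tendstoD(2)[OF e0, of "r\<^sup>2 / 8"] by simp
    then obtain N where N: "\<And>i. i \<ge> N \<Longrightarrow> e i < r\<^sup>2 / 8" unfolding eventually_sequentially by blast
    have "norm (X i - X j) < r" if "i \<ge> N" "j \<ge> N" for i j
    proof -
      have "(norm (X i - X j))\<^sup>2 < r\<^sup>2" using close[of i j] N[OF that(1)] N[OF that(2)] by argo
      then show ?thesis using r by (simp add: power2_less_imp_less)
    qed
    then show "\<exists>M. \<forall>m\<ge>M. \<forall>n\<ge>M. norm (X m - X n) < r" by blast
  qed
  then obtain v where v: "X \<longlonglongrightarrow> v" using Cauchy_convergent convergent_def by blast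
  have "(\<lambda>n. g (X n)) \<longlonglongrightarrow> g v" unfolding g_def
    by (intro tendsto_intros f.tendsto v) simp
  moreover have "(\<lambda>n. m + e n) \<longlonglongrightarrow> m + 0" by (intro tendsto_intros e0)
  ultimately have gv: "g v \<le> m"
    using LIMSEQ_le[of "\<lambda>n. g (X n)" "g v" "\<lambda>n. m + e n" m] X
    by (simp add: less_imp_le)
  have "f x = inner x v" for x
  proof (cases "x = 0")
    case False
    define d where "d = inner x v - f x"
    have quadratic: "0 \<le> t * d + t\<^sup>2 * (norm x)\<^sup>2 / 2" for t
    proof -
      have "(norm (v + t *\<^sub>R x))\<^sup>2 = (norm v)\<^sup>2 + 2 * (t * inner x v) + t\<^sup>2 * (norm x)\<^sup>2"
        by (simp add: power2_norm_eq_inner inner_add_left inner_add_right inner_commute[of v x]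
            power2_eq_square[of t] distrib_left)
      then have "g (v + t *\<^sub>R x) = g v + (t * d + t\<^sup>2 * (norm x)\<^sup>2 / 2)"
        by (simp add: g_def d_def f.add f.scaleR field_simps)
      then show ?thesis using m_le[of "v + t *\<^sub>R x"] gv by linarith
    qed
    define N where "N = (norm x)\<^sup>2"
    have N: "N > 0" using False by (simp add: N_def)
    have "- d / N * d + (- d / N)\<^sup>2 * N / 2 = - (d\<^sup>2 / (2 * N))"
      using N by (simp add: field_simps power2_eq_square)
    then have "d\<^sup>2 / (2 * N) \<le> 0" using quadratic[of "- d / N"] unfolding N_def[symmetric] by argo
    then have "d = 0" using N by (simp add: divide_le_0_iff)
    then show ?thesis unfolding d_def by simp
  qed simp
  then show ?thesis by blast
qed

lemma inner_eqI:
  fixes u v :: "'a::real_inner"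
  assumes "\<And>x. inner x u = inner x v"
  shows "u = v"
  using assms[of "u - v"] by (metis inner_diff_right inner_eq_zero_iff right_minus_eq)

lemma bounded_linear_adjoint_exists:
  fixes T :: "'a::{real_inner, banach} \<Rightarrow> 'a"
  assumes "bounded_linear T"
  obtains T' where "bounded_linear T'" "\<And>x y. inner (T x) y = inner x (T' y)"
proof -
  interpret T: bounded_linear T by fact
  have "\<exists>v. \<forall>x. inner (T x) y = inner x v" for y
    by (rule riesz_representation) (intro bounded_linear_intros T.bounded_linear_axioms)
  then obtain T' where T': "\<And>x y. inner (T x) y = inner x (T' y)" by metis
  obtain K where K: "0 < K" "\<And>x. norm (T x) \<le> norm x * K" using T.pos_bounded by blast
  have "bounded_linear T'"
  proof (rule bounded_linear_intro[where K = K])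
    show "T' (x + y) = T' x + T' y" for x y
      by (rule inner_eqI) (simp add: inner_add_right T'[symmetric])
    show "T' (r *\<^sub>R x) = r *\<^sub>R T' x" for r x
      by (rule inner_eqI) (simp add: T'[symmetric])
    show "norm (T' y) \<le> norm y * K" for y
    proof -
      have "norm (T' y) * norm (T' y) = inner (T (T' y)) y"
        by (simp add: T' power2_norm_eq_inner[symmetric] power2_eq_square)
      also have "\<dots> \<le> (norm (T' y) * K) * norm y"
        by (rule order_trans[OF norm_cauchy_schwarz]) (intro mult_right_mono K norm_ge_zero)
      finally have "norm (T' y) * norm (T' y) \<le> norm (T' y) * (norm y * K)" by (simp add: mult_ac)
      then show ?thesis using K(1) by (cases "norm (T' y) = 0") auto
    qed
  qed
  then show thesis using T' that by blast
qed

section \<open>The Banach algebra of bounded operators\<close>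

text \<open>
  Bounded operators are paired with a complex number, multiplication being componentwise. The
  second component only serves to make the norm of the unit \<open>1\<close> and to keep \<open>0 \<noteq> 1\<close> when the
  space is trivial, as the class of unital normed algebras demands; this gives access to the
  exponential series and its functional equation. The scalar is complex, not real, so that the
  algebra over a complex space contains a square root \<open>(\<i>, \<i>)\<close> of \<open>- 1\<close>.
\<close>

context notes [[typedef_overloaded]] begin

datatype 'a opalg = Op (op_part: "'a::real_normed_vector \<Rightarrow>\<^sub>L 'a") (scalar_part: complex)

end

instantiation opalg :: (real_normed_vector) real_normed_algebra_1
begin

definition "0 = Op 0 0"
definition "1 = Op id_blinfun 1"
definition "X + Y = Op (op_part X + op_part Y) (scalar_part X + scalar_part Y)"
definition "X - Y = Op (op_part X - op_part Y) (scalar_part X - scalar_part Y)"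
definition "- X = Op (- op_part X) (- scalar_part X)"
definition "X * Y = Op (op_part X o\<^sub>L op_part Y) (scalar_part X * scalar_part Y)"
definition "r *\<^sub>R X = Op (r *\<^sub>R op_part X) (r *\<^sub>R scalar_part X)"
definition "norm X = max (norm (op_part X)) (norm (scalar_part X))"
definition "dist (X :: 'a opalg) Y = norm (X - Y)"
definition "sgn (X :: 'a opalg) = inverse (norm X) *\<^sub>R X"
definition [code del]:
  "(uniformity :: ('a opalg \<times> 'a opalg) filter) = (INF e\<in>{0 <..}. principal {(X, Y). dist X Y < e})"
definition [code del]:
  "open (U :: 'a opalg set) \<longleftrightarrow> (\<forall>X\<in>U. eventually (\<lambda>(X', Y). X' = X \<longrightarrow> Y \<in> U) uniformity)"

lemmas opalg_defs = zero_opalg_def one_opalg_def plus_opalg_def minus_opalg_def uminus_opalg_def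
  times_opalg_def scaleR_opalg_def norm_opalg_def

instance
proof
  fix X Y Z :: "'a opalg" and r s :: real
  show "X + Y + Z = X + (Y + Z)" "X + Y = Y + X" "0 + X = X" "- X + X = 0" "X - Y = X + - Y"
    "r *\<^sub>R (X + Y) = r *\<^sub>R X + r *\<^sub>R Y" "(r + s) *\<^sub>R X = r *\<^sub>R X + s *\<^sub>R X"
    "r *\<^sub>R s *\<^sub>R X = (r * s) *\<^sub>R X" "1 *\<^sub>R X = X"
    by (simp_all add: opalg_defs algebra_simps)
  show "X * Y * Z = X * (Y * Z)" "(X + Y) * Z = X * Z + Y * Z" "X * (Y + Z) = X * Y + X * Z"
    "r *\<^sub>R X * Y = r *\<^sub>R (X * Y)" "X * r *\<^sub>R Y = r *\<^sub>R (X * Y)" "1 * X = X" "X * 1 = X"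
    by (auto simp: opalg_defs algebra_simps blinfun.bilinear_simps intro!: blinfun_eqI opalg.expand)
  show "(0 :: 'a opalg) \<noteq> 1" by (simp add: opalg_defs)
  show "norm (1 :: 'a opalg) = 1" by (simp add: opalg_defs norm_blinfun_id_le max_def antisym)
  show "norm X = 0 \<longleftrightarrow> X = 0"
    by (auto simp: opalg_defs max_def opalg.expand split: if_splits)
  show "norm (X + Y) \<le> norm X + norm Y"
    by (auto simp: opalg_defs intro!: norm_triangle_mono)
  show "norm (r *\<^sub>R X) = \<bar>r\<bar> * norm X"
    by (simp add: opalg_defs max_mult_distrib_left)
  show "norm (X * Y) \<le> norm X * norm Y"
    by (auto simp: opalg_defs norm_mult le_max_iff_disj intro!: norm_blinfun_compose[THEN order_trans] mult_mono)
qed (simp_all add: dist_opalg_def sgn_opalg_def uniformity_opalg_def open_opalg_def)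

end

instance opalg :: (banach) banach
proof
  fix X :: "nat \<Rightarrow> 'a opalg" assume C: "Cauchy X"
  have le: "norm (op_part Y - op_part Z) \<le> norm (Y - Z)"
    "norm (scalar_part Y - scalar_part Z) \<le> norm (Y - Z)" for Y Z :: "'a opalg"
    by (simp_all add: opalg_defs)
  have "Cauchy (\<lambda>n. op_part (X n))" "Cauchy (\<lambda>n. scalar_part (X n))"
    using C le unfolding Cauchy_iff by (meson le_less_trans)+
  then obtain T c where T: "(\<lambda>n. op_part (X n)) \<longlonglongrightarrow> T" and c: "(\<lambda>n. scalar_part (X n)) \<longlonglongrightarrow> c"
    using Cauchy_convergent convergent_def by metis
  have "(\<lambda>n. max (norm (op_part (X n) - T)) (norm (scalar_part (X n) - c))) \<longlonglongrightarrow> max (norm (T - T)) (norm (c - c))"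
    by (intro tendsto_intros T c)
  then have "(\<lambda>n. norm (X n - Op T c)) \<longlonglongrightarrow> 0" by (simp add: opalg_defs)
  then have "X \<longlonglongrightarrow> Op T c" using LIM_zero_iff tendsto_norm_zero_iff by blast
  then show "convergent X" unfolding convergent_def by blast
qed

definition app :: "'a::real_normed_vector opalg \<Rightarrow> 'a \<Rightarrow> 'a"
  where "app X = blinfun_apply (op_part X)"

lemma app_simps:
  "app (X + Y) x = app X x + app Y x" "app (X - Y) x = app X x - app Y x" "app (- X) x = - app X x"
  "app (r *\<^sub>R X) x = r *\<^sub>R app X x" "app 0 x = 0" "app 1 x = x" "app (X * Y) x = app X (app Y x)"
  by (simp_all add: app_def opalg_defs blinfun.bilinear_simps)

lemma app_Op: "bounded_linear T \<Longrightarrow> app (Op (Blinfun T) c) x = T x"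
  by (simp add: app_def bounded_linear_Blinfun_apply)

lemma norm_app_le: "norm (app X x) \<le> norm X * norm x"
  unfolding app_def by (rule order_trans[OF norm_blinfun]) (simp add: norm_opalg_def mult_right_mono)

lemma bounded_linear_app: "bounded_linear (app X)"
  unfolding app_def by (rule blinfun.bounded_linear_right)

lemma bounded_linear_app_left: "bounded_linear (\<lambda>X. app X x)"
  by (rule bounded_linear_intro[where K = "norm x"]) (simp_all add: app_simps norm_app_le)

lemma continuous_on_app: "continuous_on S (\<lambda>X. app X x)"
  by (rule linear_continuous_on[OF bounded_linear_app_left])

section \<open>Positive operators and their square roots\<close>

text \<open>
  With \<open>Q = 1 - P\<close>, a square root \<open>1 - L\<close> of \<open>P\<close> is given by a fixed point
  \<open>L = (Q + L\<^sup>2) / 2\<close>. The iterates \<open>Y n\<close> starting at \<open>0\<close> converge in norm even in the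
  borderline case of norm \<open>1\<close>, since their increments are dominated by those of the scalar
  iteration with \<open>Q = 1\<close>, which increases and is bounded by \<open>1\<close>. The iterates are polynomials
  in \<open>P\<close>; the clause on sets \<open>S\<close> transfers to the root what such polynomials inherit from \<open>P\<close>,
  namely symmetry and the operators it commutes with.
\<close>

lemma square_root_near_one:
  fixes P :: "'b::{real_normed_algebra_1, banach}"
  assumes "norm (1 - P) \<le> 1"
  shows "\<exists>R. R * R = P \<and> norm (1 - R) \<le> 1 \<and>
    (\<forall>S. closed S \<longrightarrow> subspace S \<longrightarrow> 1 \<in> S \<longrightarrow> P \<in> S \<longrightarrow> (\<forall>X\<in>S. X * X \<in> S) \<longrightarrow> R \<in> S)"
proof -
  define Q where "Q = 1 - P"
  define Y where "Y = rec_nat 0 (\<lambda>_ X. (1/2) *\<^sub>R (Q + X * X))"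
  define y :: "nat \<Rightarrow> real" where "y = rec_nat 0 (\<lambda>_ t. (1 + t * t) / 2)"
  have Y_simps [simp]: "Y 0 = 0" "Y (Suc n) = (1/2) *\<^sub>R (Q + Y n * Y n)" for n
    by (simp_all add: Y_def)
  have y_simps [simp]: "y 0 = 0" "y (Suc n) = (1 + y n * y n) / 2" for n
    by (simp_all add: y_def)
  have Q: "norm Q \<le> 1" using assms by (simp add: Q_def)
  have y01: "0 \<le> y n \<and> y n \<le> 1" for n
    by (induction n) (auto intro!: mult_le_one)
  have "y n \<le> y (Suc n)" for n
  proof -
    have "0 \<le> (1 - y n)\<^sup>2" by simp
    then show ?thesis by (simp add: power2_eq_square algebra_simps)
  qed
  then have "convergent y"
    using y01 by (metis incseq_SucI incseq_convergent convergentI)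
  have Yy: "norm (Y n) \<le> y n" for n
  proof (induction n)
    case (Suc n)
    have "norm (Y n * Y n) \<le> y n * y n"
      using norm_mult_ineq[of "Y n" "Y n"] mult_mono[OF Suc Suc] y01[of n] by force
    then have "norm (Q + Y n * Y n) \<le> 1 + y n * y n"
      using Q norm_triangle_ineq[of Q "Y n * Y n"] by linarith
    then show ?case by simp
  qed simp
  have step: "norm (Y (Suc n) - Y n) \<le> y (Suc n) - y n" for n
  proof (induction n)
    case 0
    then show ?case using Q by simp
  next
    case (Suc n)
    define U V where "U = Y (Suc n)" and "V = Y n"
    define u v where "u = y (Suc n)" and "v = y n"
    have IH: "norm (U - V) \<le> u - v" and nU: "norm U \<le> u" and nV: "norm V \<le> v"
      using Suc Yy[of n] Yy[of "Suc n"] unfolding U_def V_def u_def v_def by blast+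
    then have uv: "0 \<le> u - v" by (meson norm_ge_zero order_trans)
    \<comment> \<open>This splitting is valid without commutativity.\<close>
    have "U * U - V * V = (U - V) * U + V * (U - V)" by (simp add: algebra_simps)
    also have "norm \<dots> \<le> norm (U - V) * norm U + norm V * norm (U - V)"
      by (meson norm_triangle_mono norm_mult_ineq)
    also have "\<dots> \<le> (u - v) * u + v * (u - v)"
      using IH nU nV uv by (intro add_mono mult_mono) (auto intro: order_trans[OF norm_ge_zero])
    also have "\<dots> = u * u - v * v" by (simp add: algebra_simps)
    finally have "norm ((1/2) *\<^sub>R (U * U - V * V)) \<le> (u * u - v * v) / 2" by simp
    moreover have "Y (Suc (Suc n)) = (1/2) *\<^sub>R (Q + U * U)" "Y (Suc n) = (1/2) *\<^sub>R (Q + V * V)"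
      unfolding U_def V_def by (rule Y_simps(2))+
    then have "Y (Suc (Suc n)) - Y (Suc n) = (1/2) *\<^sub>R (U * U - V * V)"
      by (simp only:) (simp add: scaleR_right_diff_distrib scaleR_right_distrib)
    moreover have "y (Suc (Suc n)) = (1 + u * u) / 2" "y (Suc n) = (1 + v * v) / 2"
      unfolding u_def v_def by (rule y_simps(2))+
    then have "y (Suc (Suc n)) - y (Suc n) = (u * u - v * v) / 2"
      by (simp only:) (simp add: field_simps)
    ultimately show ?case by (simp only:)
  qed
  have "summable (\<lambda>n. y (Suc n) - y n)"
    using \<open>convergent y\<close> telescope_summable unfolding convergent_def by blast
  then have "summable (\<lambda>n. Y (Suc n) - Y n)"
    by (rule summable_comparison_test'[where N=0]) (rule step)
  then have "convergent (\<lambda>n. \<Sum>i<n. Y (Suc i) - Y i)"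
    unfolding summable_iff_convergent .
  then have "convergent Y" by (simp only: sum_lessThan_telescope) (simp add: convergent_def)
  then obtain L where L: "Y \<longlonglongrightarrow> L" unfolding convergent_def by blast
  have "(\<lambda>n. Y (Suc n)) \<longlonglongrightarrow> (1/2) *\<^sub>R (Q + L * L)"
    unfolding Y_simps by (intro tendsto_intros L)
  then have fixpoint: "L = (1/2) *\<^sub>R (Q + L * L)"
    using L LIMSEQ_unique LIMSEQ_Suc by blast
  then have "2 *\<^sub>R L = Q + L * L" by (metis field_sum_of_halves scaleR_2 scaleR_half_double scaleR_right_distrib)
  then have "(1 - L) * (1 - L) = P"
    by (simp add: Q_def algebra_simps scaleR_2)
  moreover have "norm (1 - (1 - L)) \<le> 1"
  proof -
    have "norm L \<le> 1"
      by (rule Lim_bounded[OF tendsto_norm[OF L], of 0]) (meson Yy y01 order_trans)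
    then show ?thesis by simp
  qed
  moreover have "1 - L \<in> S"
    if S: "closed S" "subspace S" "1 \<in> S" "P \<in> S" "\<forall>X\<in>S. X * X \<in> S" for S
  proof -
    have "Y n \<in> S" for n
      using S by (induction n) (auto simp: Q_def intro!: subspace_0 subspace_scale subspace_add subspace_diff)
    then have "L \<in> S" using S(1) L closed_sequentially by blast
    then show ?thesis using S by (simp add: subspace_diff)
  qed
  ultimately show ?thesis by blast
qed

text \<open>
  On a complex space positivity forces symmetry; for the real inner product, symmetry has to be
  part of the definition.
\<close>

definition real_positive :: "('a::real_inner \<Rightarrow> 'a) \<Rightarrow> bool"
  where "real_positive T \<longleftrightarrow> bounded_linear T \<and> (\<forall>x y. inner (T x) y = inner x (T y)) \<and>
    (\<forall>x. 0 \<le> inner (T x) x)"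

text \<open>
  This is the operator inequality \<open>T\<^sup>2 \<le> K T\<close>. It replaces the Cauchy--Schwarz inequality for
  the semidefinite form of \<open>T\<close>, and comes from evaluating that form at \<open>K x - T x\<close>.
\<close>

lemma real_positive_norm_bound:
  assumes T: "real_positive T" and K: "\<And>x. norm (T x) \<le> K * norm x" "0 < K"
  shows "(norm (T x))\<^sup>2 \<le> K * inner (T x) x"
proof -
  interpret T: bounded_linear T using T by (simp add: real_positive_def)
  define u where "u = T x"
  have sym: "inner (T u) x = inner u u" using T by (simp add: real_positive_def u_def)
  have "inner (T u) u \<le> norm (T u) * norm u" by (rule norm_cauchy_schwarz)
  also have "\<dots> \<le> (K * norm u) * norm u" by (intro mult_right_mono K) simp
  finally have Tu: "inner (T u) u \<le> K * inner u u"
    by (simp add: power2_norm_eq_inner[symmetric] power2_eq_square)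
  have "0 \<le> inner (T (K *\<^sub>R x - u)) (K *\<^sub>R x - u)" using T unfolding real_positive_def by blast
  also have "\<dots> = K * (K * inner u x) - 2 * (K * inner u u) + inner (T u) u"
    using sym by (simp add: T.diff T.scaleR inner_diff_left inner_diff_right inner_commute u_def algebra_simps)
  finally have "K * inner u u \<le> K * (K * inner u x)" using Tu by linarith
  then show ?thesis using K(2) by (simp add: u_def power2_norm_eq_inner)
qed

text \<open>
  After scaling by a bound \<open>K\<close> one has \<open>0 \<le> q \<le> 1\<close>, hence \<open>\<parallel>1 - q\<parallel> \<le> 1\<close>, and the root near the
  unit exists. Its distance at most \<open>1\<close> from the identity is what makes it positive.
\<close>

lemma real_positive_sqrt_exists:
  fixes p :: "'a::{real_inner, banach} \<Rightarrow> 'a"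
  assumes p: "real_positive p"
  obtains r where "real_positive r" "\<And>x. r (r x) = p x"
    "\<And>c x. bounded_linear c \<Longrightarrow> c \<circ> p = p \<circ> c \<Longrightarrow> c (r x) = r (c x)"
proof -
  interpret p: bounded_linear p using p by (simp add: real_positive_def)
  obtain K where K: "0 < K" "\<And>x. norm (p x) \<le> K * norm x"
    using p.pos_bounded by (metis mult.commute)
  define q where "q x = p x /\<^sub>R K" for x
  have "bounded_linear q" unfolding q_def by (intro bounded_linear_intros p.bounded_linear_axioms)
  define P where "P = Op (Blinfun q) 1"
  have app_P: "app P x = q x" for x
    unfolding P_def by (rule app_Op) fact
  have "norm (app (1 - P) x) \<le> 1 * norm x" for x
  proof -
    have "(norm (p x))\<^sup>2 \<le> K * inner (p x) x" by (rule real_positive_norm_bound[OF p K(2) K(1)])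
    then have "(norm (q x))\<^sup>2 \<le> inner (q x) x"
      using K(1) by (simp add: q_def power2_eq_square field_simps)
    moreover have "0 \<le> inner (p x) x" using p unfolding real_positive_def by blast
    then have "0 \<le> inner (q x) x" using K(1) by (simp add: q_def)
    moreover have "(norm (x - q x))\<^sup>2 = (norm x)\<^sup>2 - 2 * inner (q x) x + (norm (q x))\<^sup>2"
      by (simp add: power2_norm_eq_inner inner_diff_left inner_diff_right inner_commute)
    ultimately have "(norm (x - q x))\<^sup>2 \<le> (norm x)\<^sup>2" by linarith
    then have "norm (x - q x) \<le> norm x" by (rule power2_le_imp_le) simp
    then show ?thesis by (simp add: app_simps app_P)
  qed
  then have "norm (op_part (1 - P)) \<le> 1"
    unfolding app_def by (intro norm_blinfun_bound) simp_all
  moreover have "scalar_part (1 - P) = 0" by (simp add: minus_opalg_def one_opalg_def P_def)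
  ultimately have "norm (1 - P) \<le> 1" unfolding norm_opalg_def by simp
  from square_root_near_one[OF this] obtain R where RR: "R * R = P" and R1: "norm (1 - R) \<le> 1" and
    RS': "\<forall>S. closed S \<longrightarrow> subspace S \<longrightarrow> 1 \<in> S \<longrightarrow> P \<in> S \<longrightarrow> (\<forall>X\<in>S. X * X \<in> S) \<longrightarrow> R \<in> S"
    by (elim exE conjE)
  note RS = RS'[rule_format]
  define r where "r x = sqrt K *\<^sub>R app R x" for x
  have symR: "inner (app R x) y = inner x (app R y)" for x y
  proof -
    define S where "S = {X :: 'a opalg. \<forall>x y. inner (app X x) y = inner x (app X y)}"
    have "R \<in> S"
    proof (rule RS)
      have "S = (\<Inter>x. \<Inter>y. {X. inner (app X x) y = inner x (app X y)})" unfolding S_def by auto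
      also have "closed \<dots>"
        by (intro closed_INT ballI closed_Collect_eq continuous_intros continuous_on_app)
      finally show "closed S" .
      show "subspace S" unfolding S_def subspace_def
        by (auto simp: app_simps inner_add_left inner_add_right)
      show "1 \<in> S" "\<And>X. X \<in> S \<Longrightarrow> X * X \<in> S" unfolding S_def by (auto simp: app_simps)
      show "P \<in> S" unfolding S_def using p by (auto simp: app_P q_def real_positive_def)
    qed
    then show ?thesis unfolding S_def by blast
  qed
  have posR: "0 \<le> inner (app R x) x" for x
  proof -
    have "inner (x - app R x) x \<le> norm (app (1 - R) x) * norm x"
      using norm_cauchy_schwarz[of "x - app R x" x] by (simp add: app_simps)
    also have "\<dots> \<le> (1 * norm x) * norm x"
      by (intro mult_right_mono order_trans[OF norm_app_le] R1) simp_all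
    also have "\<dots> = inner x x" by (simp add: power2_norm_eq_inner[symmetric] power2_eq_square)
    finally show ?thesis by (simp add: inner_diff_left)
  qed
  show thesis
  proof
    show "real_positive r" unfolding real_positive_def r_def
      using symR posR bounded_linear_app K(1) by (auto intro!: bounded_linear_intros)
    show "r (r x) = p x" for x
    proof -
      have "r (r x) = K *\<^sub>R app (R * R) x"
        using K(1) by (simp add: r_def app_simps linear_scale[OF bounded_linear.linear[OF bounded_linear_app]])
      then show ?thesis using K(1) by (simp add: RR app_P q_def)
    qed
    show "c (r x) = r (c x)" if c: "bounded_linear c" and comm: "c \<circ> p = p \<circ> c" for c x
    proof -
      interpret c: bounded_linear c by fact
      define S where "S = {X :: 'a opalg. \<forall>x. c (app X x) = app X (c x)}"
      have "R \<in> S"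
      proof (rule RS)
        have "S = (\<Inter>x. {X. c (app X x) = app X (c x)})" unfolding S_def by auto
        also have "closed \<dots>"
          by (intro closed_INT ballI closed_Collect_eq c.continuous_on continuous_on_app)
        finally show "closed S" .
        show "subspace S" unfolding S_def subspace_def
          by (auto simp: app_simps c.add c.scaleR c.zero)
        show "1 \<in> S" "\<And>X. X \<in> S \<Longrightarrow> X * X \<in> S" unfolding S_def by (auto simp: app_simps)
        show "P \<in> S" unfolding S_def using comm
          by (auto simp: app_P q_def c.scaleR fun_eq_iff)
      qed
      then show ?thesis unfolding S_def r_def by (simp add: c.scaleR)
    qed
  qed
qed

text \<open>
  The square root is operator monotone: \<open>S\<^sup>2 \<le> T\<^sup>2\<close> implies \<open>S \<le> T\<close>. It is essential below that
  \<open>S\<close> may be any symmetric operator, positive or not.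

  Suppose that \<open>\<mu>\<close>, the infimum of the form of \<open>D = T - S\<close> over unit vectors, is negative. Vectors
  \<open>u\<close> nearly attaining it are approximate eigenvectors, \<open>D u \<approx> \<mu> u\<close>, because \<open>D - \<mu>\<close> is
  positive and small at \<open>u\<close>. The hypothesis says
  \<open>0 \<le> \<parallel>T u\<parallel>\<^sup>2 - \<parallel>S u\<parallel>\<^sup>2 = \<langle>D u, (T + S) u\<rangle>\<close>, which is close to \<open>\<mu> \<langle>u, (T + S) u\<rangle>\<close>, while
  \<open>\<langle>u, (T + S) u\<rangle> = 2 \<langle>T u, u\<rangle> - \<langle>D u, u\<rangle>\<close> is at least about \<open>- \<mu>\<close>; so \<open>0 \<le> - \<mu>\<^sup>2\<close> in
  the limit.
\<close>

lemma norm_le_imp_inner_le: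
  fixes S T :: "'a::real_inner \<Rightarrow> 'a"
  assumes S: "bounded_linear S" "\<And>x y. inner (S x) y = inner x (S y)"
    and T: "real_positive T" and le: "\<And>x. norm (S x) \<le> norm (T x)"
  shows "inner (S x) x \<le> inner (T x) x"
proof (rule ccontr)
  assume neg: "\<not> ?thesis"
  have T': "bounded_linear T" "\<And>x y. inner (T x) y = inner x (T y)" "\<And>x. 0 \<le> inner (T x) x"
    using T by (auto simp: real_positive_def)
  interpret S: bounded_linear S by fact
  interpret T: bounded_linear T by fact
  define D where "D u = T u - S u" for u
  have "bounded_linear D" unfolding D_def by (intro bounded_linear_intros S T')
  interpret D: bounded_linear D by fact
  have D_sym: "inner (D u) v = inner u (D v)" for u v
    by (simp add: D_def inner_diff_left inner_diff_right S T')
  obtain K where K: "0 < K" "\<And>u. norm (D u) \<le> K * norm u" using D.pos_bounded by (metis mult.commute)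
  obtain L where L: "0 < L" "\<And>u. norm (T u + S u) \<le> L * norm u"
    using bounded_linear.pos_bounded[OF bounded_linear_add[OF T'(1) S(1)]] by (metis mult.commute)
  define M where "M = {inner (D u) u | u. norm u = 1}"
  have nx: "0 < norm x" using neg by auto
  have M_memb: "inner (D u) u / (norm u)\<^sup>2 \<in> M" if "u \<noteq> 0" for u
    unfolding M_def using that
    by (auto intro!: exI[of _ "u /\<^sub>R norm u"] simp: D.scaleR power2_eq_square field_simps)
  have bdd: "bdd_below M"
  proof -
    have "- K \<le> inner (D u) u" if "norm u = 1" for u
      using Cauchy_Schwarz_ineq2[of "D u" u] K(2)[of u] that by simp
    then show ?thesis unfolding M_def by (auto simp: bdd_below_def)
  qed
  define \<mu> where "\<mu> = Inf M"
  have \<mu>_le: "\<mu> * (norm u)\<^sup>2 \<le> inner (D u) u" for u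
  proof (cases "u = 0")
    case False
    then have "\<mu> \<le> inner (D u) u / (norm u)\<^sup>2"
      unfolding \<mu>_def by (intro cInf_lower M_memb bdd)
    then show ?thesis using False by (simp add: field_simps)
  qed (simp add: D.zero)
  have "\<mu> < 0"
  proof -
    have "inner (D x) x < 0" using neg by (simp add: D_def inner_diff_left)
    then have "\<mu> * (norm x)\<^sup>2 < 0" using \<mu>_le[of x] by linarith
    then show ?thesis by (simp add: mult_less_0_iff)
  qed
  have "M \<noteq> {}" using M_memb[of x] nx by force
  then have "\<mu> \<in> closure M" unfolding \<mu>_def by (rule closure_contains_Inf[OF _ bdd])
  then obtain a where a: "\<And>n. a n \<in> M" "a \<longlonglongrightarrow> \<mu>" unfolding closure_sequential by blast
  define P where "P u = D u - \<mu> *\<^sub>R u" for u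
  have "real_positive P" unfolding real_positive_def P_def
    using \<mu>_le D_sym
    by (auto intro!: bounded_linear_intros D.bounded_linear_axioms
        simp: inner_diff_left inner_diff_right power2_norm_eq_inner)
  moreover have P_bound: "norm (P u) \<le> (K + \<bar>\<mu>\<bar>) * norm u" for u
    using norm_triangle_ineq4[of "D u" "\<mu> *\<^sub>R u"] K(2)[of u] by (simp add: P_def algebra_simps)
  ultimately have P_small: "(norm (P u))\<^sup>2 \<le> (K + \<bar>\<mu>\<bar>) * inner (P u) u" for u
    by (rule real_positive_norm_bound) (use K in auto)
  have "0 \<le> - \<mu> * a n + sqrt ((K + \<bar>\<mu>\<bar>) * (a n - \<mu>)) * L" for n
  proof -
    obtain u where u: "norm u = 1" "a n = inner (D u) u" using a(1)[of n] unfolding M_def by blast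
    have "inner u u = 1" using u(1) by (simp add: power2_norm_eq_inner[symmetric])
    then have "norm (P u) \<le> sqrt ((K + \<bar>\<mu>\<bar>) * (a n - \<mu>))"
      using P_small[of u] u by (intro real_le_rsqrt) (simp add: P_def inner_diff_left)
    moreover from this have "0 \<le> sqrt ((K + \<bar>\<mu>\<bar>) * (a n - \<mu>))" by (rule order_trans[OF norm_ge_zero])
    ultimately have err: "norm (P u) * norm (T u + S u) \<le> sqrt ((K + \<bar>\<mu>\<bar>) * (a n - \<mu>)) * L"
      using L(2)[of u] u(1) by (intro mult_mono) simp_all
    have "(norm (S u))\<^sup>2 \<le> (norm (T u))\<^sup>2" using le[of u] by (simp add: power_mono)
    then have "0 \<le> inner (D u) (T u + S u)"
      by (simp add: D_def power2_norm_eq_inner inner_diff_left inner_add_right inner_commute[of "S u" "T u"])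
    also have "\<dots> = \<mu> * inner u (T u + S u) + inner (P u) (T u + S u)"
      by (simp add: P_def inner_diff_left)
    also have "\<dots> \<le> \<mu> * (- a n) + norm (P u) * norm (T u + S u)"
    proof (rule add_mono[OF mult_left_mono_neg])
      show "- a n \<le> inner u (T u + S u)"
        using T'(3)[of u] by (simp add: u D_def inner_diff_left inner_add_right inner_commute[of u])
    qed (use \<open>\<mu> < 0\<close> norm_cauchy_schwarz in auto)
    finally show ?thesis using err by simp
  qed
  moreover have "(\<lambda>n. - \<mu> * a n + sqrt ((K + \<bar>\<mu>\<bar>) * (a n - \<mu>)) * L) \<longlonglongrightarrow>
      - \<mu> * \<mu> + sqrt ((K + \<bar>\<mu>\<bar>) * (\<mu> - \<mu>)) * L"
    by (intro tendsto_intros a)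
  ultimately have "0 \<le> - \<mu> * \<mu> + sqrt ((K + \<bar>\<mu>\<bar>) * (\<mu> - \<mu>)) * L"
    by (intro LIMSEQ_le_const) auto
  then have "\<mu> * \<mu> \<le> 0" by simp
  then show False using \<open>\<mu> < 0\<close> by (simp add: mult_le_0_iff)
qed

lemma real_positive_norm_sq: "real_positive P \<Longrightarrow> (norm (P x))\<^sup>2 = inner (P (P x)) x"
  by (simp add: real_positive_def power2_norm_eq_inner)

text \<open>
  Monotonicity in both directions shows that the forms agree. This gives uniqueness of positive
  square roots, as \<open>\<parallel>P x\<parallel>\<close> is determined by \<open>P\<^sup>2\<close>.
\<close>

lemma real_positive_eqI:
  assumes P: "real_positive P" and Q: "real_positive Q" and n: "\<And>x. norm (P x) = norm (Q x)"
  shows "P = Q"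
proof
  fix x
  have sym: "\<And>x y. inner (P x) y = inner x (P y)" "\<And>x y. inner (Q x) y = inner x (Q y)"
    and bl: "bounded_linear P" "bounded_linear Q"
    using P Q unfolding real_positive_def by blast+
  have form: "inner (P u) u = inner (Q u) u" for u
    using norm_le_imp_inner_le[OF bl(1) sym(1) Q, of u] norm_le_imp_inner_le[OF bl(2) sym(2) P, of u]
    by (simp only: n order_refl antisym)
  have lin: "linear P" "linear Q" using bl by (simp_all add: bounded_linear.linear)
  have eq: "2 * inner (P x) y = 2 * inner (Q x) y" for y
  proof -
    have "inner (P y) x = inner (P x) y" "inner (Q y) x = inner (Q x) y"
      using sym inner_commute by metis+
    then show ?thesis
      using form[of "x + y"] form[of x] form[of y]
      by (simp add: linear_add[OF lin(1)] linear_add[OF lin(2)] inner_add_left inner_add_right)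
  qed
  show "P x = Q x"
  proof (rule inner_eqI)
    show "inner y (P x) = inner y (Q x)" for y using eq[of y] by (simp add: inner_commute[of y])
  qed
qed

section \<open>Bounded conjugation by exponentials\<close>

lemma exp_commutes:
  fixes X Y :: "'b::{real_normed_algebra_1, banach}"
  assumes "X * Y = Y * X"
  shows "exp X * Y = Y * exp X"
  using assms
  by (simp add: exp_def suminf_mult[symmetric] summable_exp_generic suminf_mult2
      power_commuting_commutes)

text \<open>
  For \<open>K = \<i> T\<close> the function is \<open>exp (z T)\<close>, a product of two real one-parameter groups.
\<close>

lemma exp_pencil_has_derivative:
  fixes T K :: "'b::{real_normed_algebra_1, banach}"
  assumes "T * K = K * T"
  shows "((\<lambda>z. exp (Re z *\<^sub>R T) * exp (Im z *\<^sub>R K)) has_derivative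
    (\<lambda>h. exp (Re z *\<^sub>R T) * exp (Im z *\<^sub>R K) * (Re h *\<^sub>R T + Im h *\<^sub>R K))) (at z)"
proof -
  have dT: "((\<lambda>z. exp (Re z *\<^sub>R T)) has_derivative (\<lambda>h. Re h *\<^sub>R (exp (Re z *\<^sub>R T) * T))) (at z)"
    by (rule has_derivative_compose[OF bounded_linear_imp_has_derivative[OF bounded_linear_Re]
          exp_scaleR_has_vector_derivative_right[unfolded has_vector_derivative_def]])
  have dK: "((\<lambda>z. exp (Im z *\<^sub>R K)) has_derivative (\<lambda>h. Im h *\<^sub>R (exp (Im z *\<^sub>R K) * K))) (at z)"
    by (rule has_derivative_compose[OF bounded_linear_imp_has_derivative[OF bounded_linear_Im]
          exp_scaleR_has_vector_derivative_right[unfolded has_vector_derivative_def]])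
  have "exp (Im z *\<^sub>R K) * T = T * exp (Im z *\<^sub>R K)"
    by (rule exp_commutes) (simp add: assms)
  then show ?thesis
    by (intro has_derivative_eq_rhs[OF has_derivative_mult[OF dT dK]])
      (simp add: fun_eq_iff distrib_left mult.assoc)
qed

text \<open>
  This is Rosenblum's argument for Fuglede's theorem, with \<open>J\<close> as imaginary unit and \<open>T\<close> in the
  role of the adjoint of \<open>N\<close>. Seen through the functional \<open>\<phi>\<close>, the function
  \<open>\<Phi> z = exp (z T) B exp (- z T)\<close> is entire. As \<open>B\<close> commutes with \<open>V = cnj z N\<close>, it is also
  \<open>exp W B exp (- W)\<close> for \<open>W = z T - cnj z N\<close>, which in the application is skew-adjoint; hence
  the bound that is assumed here. By Liouville's theorem \<open>\<Phi>\<close> is constant, and its derivative at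
  \<open>0\<close> is \<open>T B - B T\<close>.
\<close>

lemma bounded_conjugation_imp_commute:
  fixes J T N B :: "'b::{real_normed_algebra_1, banach}"
  assumes J: "J * J = - 1" and JT: "J * T = T * J" and JN: "J * N = N * J" and JB: "J * B = B * J"
    and TN: "T * N = N * T" and NB: "N * B = B * N"
    and \<phi>: "bounded_linear \<phi>" and \<phi>_J: "\<And>X. \<phi> (J * X) = \<i> * \<phi> X"
    and bounded: "\<And>s t. norm (\<phi> (exp (s *\<^sub>R (T - N) + t *\<^sub>R (J * (T + N))) * B *
      exp (- (s *\<^sub>R (T - N) + t *\<^sub>R (J * (T + N)))))) \<le> C"
  shows "\<phi> (T * B) = \<phi> (B * T)"
proof -
  interpret \<phi>: bounded_linear \<phi> by fact
  define K where "K = J * T"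
  have TK: "T * K = K * T" by (metis K_def JT mult.assoc)
  define E where "E z = exp (Re z *\<^sub>R T) * exp (Im z *\<^sub>R K)" for z
  define E' where "E' z = exp (Re z *\<^sub>R - T) * exp (Im z *\<^sub>R - K)" for z
  define \<Phi> where "\<Phi> z = E z * B * E' z" for z
  define M where "M z = E z * (T * B - B * T) * E' z" for z
  define D where "D h = Re h *\<^sub>R T + Im h *\<^sub>R K" for h
  have dE: "(E has_derivative (\<lambda>h. E z * D h)) (at z)" for z
    unfolding E_def D_def by (rule exp_pencil_has_derivative[OF TK])
  have dE': "(E' has_derivative (\<lambda>h. E' z * - D h)) (at z)" for z
    using exp_pencil_has_derivative[of "- T" "- K" z] TK unfolding E'_def D_def by simp
  have DE': "D h * E' z = E' z * D h" for h z
  proof -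
    have "X * E' z = E' z * X" if "X * T = T * X" "X * K = K * X" for X
    proof -
      have "exp (Re z *\<^sub>R - T) * X = X * exp (Re z *\<^sub>R - T)" "exp (Im z *\<^sub>R - K) * X = X * exp (Im z *\<^sub>R - K)"
        by (rule exp_commutes; simp add: that)+
      then show ?thesis unfolding E'_def by (metis mult.assoc)
    qed
    then show ?thesis using TK by (simp add: D_def algebra_simps)
  qed
  have JE: "J * E z = E z * J" for z
  proof -
    have JK: "K * J = J * K" by (metis K_def JT mult.assoc)
    have "exp (Re z *\<^sub>R T) * J = J * exp (Re z *\<^sub>R T)" "exp (Im z *\<^sub>R K) * J = J * exp (Im z *\<^sub>R K)"
      by (rule exp_commutes; simp add: JT JK)+
    then show ?thesis unfolding E_def by (metis mult.assoc)
  qed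
  have "((\<lambda>z. \<phi> (\<Phi> z)) has_field_derivative \<phi> (M z)) (at z)" for z
  proof -
    have "(\<Phi> has_derivative (\<lambda>h. E z * B * (E' z * - D h) + E z * D h * B * E' z)) (at z)"
      unfolding \<Phi>_def
      by (rule has_derivative_eq_rhs[OF has_derivative_mult[OF
            has_derivative_mult_left[OF dE] dE']]) simp
    moreover have "E z * B * (E' z * - D h) + E z * D h * B * E' z = Re h *\<^sub>R M z + Im h *\<^sub>R (J * M z)" for h
    proof -
      have "E z * B * (E' z * - D h) + E z * D h * B * E' z = E z * (D h * B - B * D h) * E' z"
        by (simp add: algebra_simps DE'[symmetric])
      also have "D h * B - B * D h = Re h *\<^sub>R (T * B - B * T) + Im h *\<^sub>R (J * (T * B - B * T))"
      proof -
        have "B * K = J * (B * T)" by (metis K_def JB mult.assoc)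
        then show ?thesis by (simp add: D_def K_def algebra_simps)
      qed
      also have "E z * \<dots> * E' z = Re h *\<^sub>R M z + Im h *\<^sub>R (E z * J * (T * B - B * T) * E' z)"
        by (simp add: M_def distrib_left distrib_right mult.assoc)
      also have "E z * J * (T * B - B * T) * E' z = J * M z"
        by (simp add: M_def mult.assoc flip: JE)
      finally show ?thesis .
    qed
    ultimately have "(\<Phi> has_derivative (\<lambda>h. Re h *\<^sub>R M z + Im h *\<^sub>R (J * M z))) (at z)" by simp
    then have "((\<lambda>z. \<phi> (\<Phi> z)) has_derivative (\<lambda>h. \<phi> (Re h *\<^sub>R M z + Im h *\<^sub>R (J * M z)))) (at z)"
      by (rule \<phi>.has_derivative)
    moreover have "\<phi> (Re h *\<^sub>R M z + Im h *\<^sub>R (J * M z)) = \<phi> (M z) * h" for h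
      by (simp add: \<phi>.add \<phi>.scaleR \<phi>_J complex_eq_iff algebra_simps)
    ultimately show ?thesis by (simp add: has_field_derivative_def)
  qed
  note deriv = this
  have "norm (\<phi> (\<Phi> z)) \<le> C" for z
  proof -
    define W where "W = Re z *\<^sub>R (T - N) + Im z *\<^sub>R (J * (T + N))"
    define V where "V = Re z *\<^sub>R N - Im z *\<^sub>R (J * N)"
    have JJ: "J * (J * X) = - X" for X using J by (metis mult.assoc mult_minus_left mult_1)
    have comm: "T * (J * X) = J * (T * X)" "N * (J * X) = J * (N * X)" "N * (T * X) = T * (N * X)"
      "B * (J * X) = J * (B * X)" "B * (N * X) = N * (B * X)" for X
      using JT JN TN JB NB by (metis mult.assoc)+
    have WV: "W * V = V * W"
      by (simp add: W_def V_def algebra_simps JJ comm TN)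
    have sum: "W + V = Re z *\<^sub>R T + Im z *\<^sub>R K"
      by (simp add: W_def V_def K_def algebra_simps)
    have "E z = exp (W + V)"
      unfolding E_def sum by (rule exp_add_commuting[symmetric]) (simp add: TK)
    then have Ez: "E z = exp W * exp V" using exp_add_commuting[OF WV] by simp
    have "E' z = exp (- V + - W)"
    proof -
      have "E' z = exp (Re z *\<^sub>R - T + Im z *\<^sub>R - K)"
        unfolding E'_def by (rule exp_add_commuting[symmetric]) (simp add: TK)
      moreover have "Re z *\<^sub>R - T + Im z *\<^sub>R - K = - V + - W" using sum by (simp add: algebra_simps)
      ultimately show ?thesis by simp
    qed
    then have E'z: "E' z = exp (- V) * exp (- W)"
      using exp_add_commuting[of "- V" "- W"] WV by simp
    have "exp V * B = B * exp V"
      by (rule exp_commutes) (simp add: V_def algebra_simps comm NB)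
    then have "exp V * B * exp (- V) = B"
      by (metis exp_minus_inverse mult.assoc mult_1_right)
    then have "\<Phi> z = exp W * B * exp (- W)"
      unfolding \<Phi>_def Ez E'z by (metis mult.assoc)
    then show ?thesis unfolding W_def using bounded by simp
  qed
  then have "bounded (range (\<lambda>z. \<phi> (\<Phi> z)))" by (auto simp: bounded_iff)
  moreover have "(\<lambda>z. \<phi> (\<Phi> z)) holomorphic_on UNIV"
    using deriv unfolding holomorphic_on_def field_differentiable_def by auto
  ultimately obtain c where "\<And>z. \<phi> (\<Phi> z) = c" using Liouville_theorem unfolding constant_on_def by blast
  then have "((\<lambda>z. \<phi> (\<Phi> z)) has_field_derivative 0) (at 0)" by simp
  then have "\<phi> (M 0) = 0" using deriv DERIV_unique by blast
  then show ?thesis by (simp add: M_def E_def E'_def \<phi>.diff)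
qed

section \<open>Adjoint and modulus on a complex Hilbert space\<close>

instance complex_hilbert_space \<subseteq> banach by standard

lemma Re_cinner: "Re (cinner x y) = inner x y"
  by (simp add: inner_eq_Re_cinner)

lemma Im_cinner: "Im (cinner x y) = - inner (\<i> *\<^sub>C x) y"
  by (simp add: inner_eq_Re_cinner cinner_scaleC_left)

lemma cinner_scaleC_right: "cinner x (c *\<^sub>C y) = cnj c * cinner x y"
  using cinner_commute[of x "c *\<^sub>C y"] cinner_commute[of x y] by (simp add: cinner_scaleC_left)

lemma inner_scaleC_left: "inner (c *\<^sub>C x) y = inner x (cnj c *\<^sub>C y)"
  by (simp add: inner_eq_Re_cinner cinner_scaleC_left cinner_scaleC_right)

lemma inner_i_skew: "inner (\<i> *\<^sub>C x) y = - inner x (\<i> *\<^sub>C y)"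
  by (simp add: inner_eq_Re_cinner cinner_scaleC_left cinner_scaleC_right)

lemma i_scaleC_twice: "\<i> *\<^sub>C \<i> *\<^sub>C x = - x"
  using scaleR_scaleC[of "-1" x] by (simp add: scaleC_scaleC)

lemma bounded_linear_scaleC: "bounded_linear (\<lambda>x::'a::complex_inner_space. c *\<^sub>C x)"
proof (rule bounded_linear_intro[where K = "cmod c"])
  show "c *\<^sub>C r *\<^sub>R x = r *\<^sub>R c *\<^sub>C x" for r and x :: 'a
    by (simp add: scaleR_scaleC scaleC_scaleC mult.commute)
  show "norm (c *\<^sub>C x) \<le> norm x * cmod c" for x :: 'a
  proof -
    have "cnj c * c = complex_of_real ((cmod c)\<^sup>2)" by (simp only: complex_norm_square mult.commute)
    then have "cnj c *\<^sub>C c *\<^sub>C x = (cmod c)\<^sup>2 *\<^sub>R x"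
      by (simp only: scaleC_scaleC scaleR_scaleC)
    then have "inner (c *\<^sub>C x) (c *\<^sub>C x) = (cmod c)\<^sup>2 * inner x x"
      by (simp only: inner_scaleC_left inner_scaleR_right)
    then have "(norm (c *\<^sub>C x))\<^sup>2 = (norm x * cmod c)\<^sup>2"
      by (simp only: power2_norm_eq_inner power_mult_distrib mult.commute)
    then show ?thesis
      by (rule power2_le_imp_le[OF eq_refl]) simp
  qed
qed (simp add: scaleC_add_right)

lemma bounded_linear_cinner_left: "bounded_linear (\<lambda>x. cinner x y)"
proof -
  have "cinner x y = Complex (inner x y) (- inner (\<i> *\<^sub>C x) y)" for x
    by (simp add: complex_eq_iff Re_cinner Im_cinner)
  moreover have "bounded_linear (\<lambda>x. of_real (inner x y) + \<i> * of_real (- inner (\<i> *\<^sub>C x) y))"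
    by (intro bounded_linear_intros bounded_linear_minus bounded_linear_compose[OF bounded_linear_of_real]
        bounded_linear_compose[OF bounded_linear_inner_left bounded_linear_scaleC])
  ultimately show ?thesis by (simp add: Complex_eq)
qed

lemma scaleC_diff_right: "c *\<^sub>C (x - y) = c *\<^sub>C x - c *\<^sub>C y"
  by (rule linear_diff[OF bounded_linear.linear[OF bounded_linear_scaleC]])

lemma bounded_clinear_diff:
  "bounded_clinear S \<Longrightarrow> bounded_clinear T \<Longrightarrow> bounded_clinear (\<lambda>x. S x - T x)"
  by (simp add: bounded_clinear_def bounded_linear_sub scaleC_diff_right)

lemma cinner_eqI: "u = v" if "\<And>x. cinner x u = cinner x v"
  by (rule inner_eqI) (simp add: inner_eq_Re_cinner that)

lemma cadjoint:
  assumes T: "bounded_clinear T"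
  shows bounded_clinear_cadjoint: "bounded_clinear (cadjoint T)"
    and cinner_cadjoint: "cinner (T x) y = cinner x (cadjoint T y)"
proof -
  have "bounded_linear T" using T by (simp add: bounded_clinear_def)
  then obtain T' where T': "bounded_linear T'" "\<And>x y. inner (T x) y = inner x (T' y)"
    using bounded_linear_adjoint_exists by blast
  have adj: "cinner (T x) y = cinner x (T' y)" for x y
  proof (rule complex_eqI)
    have "\<i> *\<^sub>C T x = T (\<i> *\<^sub>C x)" using T by (simp add: bounded_clinear_def)
    then show "Im (cinner (T x) y) = Im (cinner x (T' y))" by (simp add: Im_cinner T')
  qed (simp add: Re_cinner T')
  have "cadjoint T = T'"
    unfolding cadjoint_def
  proof (rule the_equality)
    show "S = T'" if "\<forall>x y. cinner (T x) y = cinner x (S y)" for S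
      by (rule ext, rule cinner_eqI) (simp add: that flip: adj)
  qed (simp add: adj)
  moreover have "T' (c *\<^sub>C x) = c *\<^sub>C T' x" for c x
    by (rule cinner_eqI) (simp add: adj[symmetric] cinner_scaleC_right)
  ultimately show "bounded_clinear (cadjoint T)" "cinner (T x) y = cinner x (cadjoint T y)"
    using adj T'(1) by (simp_all add: bounded_clinear_def)
qed

lemma inner_cadjoint: "bounded_clinear T \<Longrightarrow> inner (T x) y = inner x (cadjoint T y)"
  by (simp add: inner_eq_Re_cinner cinner_cadjoint)

text \<open>
  That \<open>\<langle>T x, x\<rangle>\<close> is real for all \<open>x\<close> means that the real form \<open>\<langle>\<i> T x, x\<rangle>\<close> vanishes on the
  diagonal, that is, is alternating; replacing \<open>x\<close> by \<open>\<i> x\<close> turns this into symmetry of \<open>T\<close>.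
\<close>

lemma positive_op_iff: "positive_op T \<longleftrightarrow> bounded_clinear T \<and> real_positive T"
proof (cases "bounded_clinear T")
  case True
  then have T: "bounded_linear T" and T_i: "\<And>x. T (\<i> *\<^sub>C x) = \<i> *\<^sub>C T x"
    by (auto simp: bounded_clinear_def)
  have nonneg_iff: "cinner (T x) x \<in> \<real>\<^sub>\<ge>\<^sub>0 \<longleftrightarrow> 0 \<le> inner (T x) x \<and> inner (\<i> *\<^sub>C T x) x = 0" for x
    by (simp add: complex_nonneg_Reals_iff Re_cinner Im_cinner)
  have "(\<forall>x. inner (\<i> *\<^sub>C T x) x = 0) \<longleftrightarrow> (\<forall>x y. inner (T x) y = inner x (T y))"
  proof
    assume zero: "\<forall>x. inner (\<i> *\<^sub>C T x) x = 0"
    have skew: "inner (\<i> *\<^sub>C T x) y = - inner (\<i> *\<^sub>C T y) x" for x y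
      using zero[rule_format, of "x + y"] zero[rule_format, of x] zero[rule_format, of y]
      by (simp add: linear_add[OF bounded_linear.linear[OF T]] scaleC_add_right inner_add_left inner_add_right)
    show "\<forall>x y. inner (T x) y = inner x (T y)"
    proof (intro allI)
      fix x y
      have "inner (T x) y = - inner (\<i> *\<^sub>C T (\<i> *\<^sub>C x)) y" by (simp add: T_i i_scaleC_twice)
      also have "\<dots> = inner (\<i> *\<^sub>C T y) (\<i> *\<^sub>C x)" by (simp add: skew[of "\<i> *\<^sub>C x"])
      also have "\<dots> = inner x (T y)" by (simp add: inner_i_skew i_scaleC_twice inner_commute)
      finally show "inner (T x) y = inner x (T y)" .
    qed
  next
    assume sym: "\<forall>x y. inner (T x) y = inner x (T y)"
    show "\<forall>x. inner (\<i> *\<^sub>C T x) x = 0"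
    proof
      fix x
      have "inner (\<i> *\<^sub>C T x) x = inner (\<i> *\<^sub>C x) (T x)" using sym by (simp flip: T_i)
      then show "inner (\<i> *\<^sub>C T x) x = 0" using inner_i_skew[of "T x" x] by (simp add: inner_commute)
    qed
  qed
  then show ?thesis
    using True T by (auto simp: positive_op_def real_positive_def nonneg_iff)
qed (simp add: positive_op_def)

lemma op_leI:
  assumes "positive_op S" "positive_op T" "\<And>x. inner (S x) x \<le> inner (T x) x"
  shows "op_le S T"
  using assms unfolding op_le_def positive_op_iff real_positive_def
  by (auto intro: bounded_clinear_diff bounded_linear_sub simp: inner_diff_left inner_diff_right)

text \<open>
  The square root is complex linear because it commutes with whatever \<open>T\<^sup>* T\<close> commutes with,
  scalars included.
\<close>

lemma op_abs:
  assumes T: "bounded_clinear T"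
  shows positive_op_abs: "positive_op (op_abs T)"
    and norm_op_abs: "norm (op_abs T x) = norm (T x)"
    and op_abs_commute: "bounded_linear C \<Longrightarrow> C \<circ> (cadjoint T \<circ> T) = (cadjoint T \<circ> T) \<circ> C \<Longrightarrow>
      C (op_abs T x) = op_abs T (C x)"
proof -
  define p where "p = cadjoint T \<circ> T"
  note T' = bounded_clinear_cadjoint[OF T]
  have p_C: "p (c *\<^sub>C x) = c *\<^sub>C p x" for c x using T T' by (simp add: p_def bounded_clinear_def)
  have adj': "inner (cadjoint T u) v = inner u (T v)" for u v
    using inner_cadjoint[OF T, of v u] by (simp add: inner_commute)
  have "bounded_linear p" unfolding p_def comp_def
    by (rule bounded_linear_compose) (use T T' in \<open>auto simp: bounded_clinear_def\<close>)
  then have p: "real_positive p"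
    by (simp add: real_positive_def p_def adj' flip: inner_cadjoint[OF T])
  obtain r where r: "real_positive r" and rr: "\<And>x. r (r x) = p x"
    and comm: "\<And>c x. bounded_linear c \<Longrightarrow> c \<circ> p = p \<circ> c \<Longrightarrow> c (r x) = r (c x)"
    using real_positive_sqrt_exists[OF p] by blast
  have "c *\<^sub>C r x = r (c *\<^sub>C x)" for c x
    by (rule comm[OF bounded_linear_scaleC]) (simp add: fun_eq_iff p_C)
  moreover have "bounded_linear r" using r unfolding real_positive_def by blast
  ultimately have r_pos: "positive_op r"
    using r by (simp add: positive_op_iff bounded_clinear_def)
  have "op_abs T = r"
    unfolding op_abs_def op_sqrt_def p_def[symmetric]
  proof (rule the_equality)
    show "positive_op r \<and> r \<circ> r = p" using r_pos rr by (simp add: fun_eq_iff)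
    show "P = r" if "positive_op P \<and> P \<circ> P = p" for P
    proof (rule real_positive_eqI)
      show P: "real_positive P" using that positive_op_iff by blast
      show "norm (P x) = norm (r x)" for x
      proof -
        have "P (P x) = p x" using that by (simp add: fun_eq_iff)
        then have "(norm (P x))\<^sup>2 = (norm (r x))\<^sup>2"
          by (simp only: real_positive_norm_sq[OF P] real_positive_norm_sq[OF r] rr)
        then show ?thesis by simp
      qed
    qed fact
  qed
  moreover have "(norm (r x))\<^sup>2 = (norm (T x))\<^sup>2" for x
    unfolding real_positive_norm_sq[OF r] rr by (simp add: p_def adj' power2_norm_eq_inner)
  ultimately show "positive_op (op_abs T)" "norm (op_abs T x) = norm (T x)"
    "bounded_linear C \<Longrightarrow> C \<circ> (cadjoint T \<circ> T) = (cadjoint T \<circ> T) \<circ> C \<Longrightarrow>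
      C (op_abs T x) = op_abs T (C x)"
    using r_pos comm[of C x] by (simp_all add: p_def)
qed

section \<open>Fuglede's theorem\<close>

text \<open>
  Along \<open>v t = exp (t W) u\<close> the derivative of \<open>\<parallel>v t\<parallel>\<^sup>2\<close> is \<open>2 \<langle>W (v t), v t\<rangle> = 0\<close>.
\<close>

lemma skew_exp_isometry:
  fixes W :: "'a::{real_inner, banach} opalg"
  assumes skew: "\<And>u. inner (app W u) u = 0"
  shows "norm (app (exp W) u) = norm u"
proof -
  define v where "v t = app (exp (t *\<^sub>R W)) u" for t
  have "(v has_vector_derivative app W (v t)) (at t)" for t
    using bounded_linear.has_vector_derivative[OF bounded_linear_app_left exp_scaleR_has_vector_derivative_left[of W t], of u]
    by (simp add: v_def[abs_def] app_simps)
  then have "((\<lambda>t. inner (v t) (v t)) has_vector_derivative inner (v t) (app W (v t)) + inner (app W (v t)) (v t)) (at t)" for t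
    by (intro bounded_bilinear.has_vector_derivative[OF bounded_bilinear_inner])
  then have "DERIV (\<lambda>t. inner (v t) (v t)) t :> 0" for t
    using skew by (simp add: has_real_derivative_iff_has_vector_derivative inner_commute)
  then have "inner (v 1) (v 1) = inner (v 0) (v 0)" using DERIV_isconst_all by blast
  then show ?thesis by (simp add: v_def app_simps norm_eq_sqrt_inner)
qed

text \<open>
  The operator \<open>W = z A\<^sup>* - cnj z A\<close> is skew-adjoint, so \<open>exp W\<close> and \<open>exp (- W)\<close> are isometries
  and \<open>exp W B exp (- W)\<close> is bounded uniformly in \<open>z\<close>. The functionals \<open>X \<mapsto> \<langle>X x, y\<rangle>\<close> separate
  operators.
\<close>

theorem fuglede:
  fixes A B :: "'a::complex_hilbert_space \<Rightarrow> 'a"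
  assumes A: "bounded_clinear A" and B: "bounded_clinear B"
    and normal: "normal_op A" and AB: "A \<circ> B = B \<circ> A"
  shows "cadjoint A (B x) = B (cadjoint A x)"
proof -
  note A' = bounded_clinear_cadjoint[OF A]
  define op where "op S c = Op (Blinfun S) c" for S :: "'a \<Rightarrow> 'a" and c
  define J T N B0 where "J = op (\<lambda>x. \<i> *\<^sub>C x) \<i>" and "T = op (cadjoint A) 0" and "N = op A 0" and "B0 = op B 0"
  have bl: "bounded_linear A" "bounded_linear B" "bounded_linear (cadjoint A)"
    using A B A' by (auto simp: bounded_clinear_def)
  have app: "app J u = \<i> *\<^sub>C u" "app T u = cadjoint A u" "app N u = A u" "app B0 u = B u" for u
    unfolding J_def T_def N_def B0_def op_def by (rule app_Op; intro bl bounded_linear_scaleC)+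
  have scalar: "scalar_part J = \<i>" "scalar_part T = 0" "scalar_part N = 0" "scalar_part B0 = 0"
    by (simp_all add: J_def T_def N_def B0_def op_def)
  have scalar_simps: "scalar_part (X * Y) = scalar_part X * scalar_part Y" "scalar_part (- X) = - scalar_part X"
    "scalar_part 1 = 1" for X Y :: "'a opalg" by (simp_all add: opalg_defs)
  have eqI: "X = Y" if "\<And>u. app X u = app Y u" "scalar_part X = scalar_part Y" for X Y :: "'a opalg"
    using that by (auto intro!: opalg.expand blinfun_eqI simp: app_def)
  have i: "A (\<i> *\<^sub>C u) = \<i> *\<^sub>C A u" "B (\<i> *\<^sub>C u) = \<i> *\<^sub>C B u" "cadjoint A (\<i> *\<^sub>C u) = \<i> *\<^sub>C cadjoint A u" for u
    using A B A' by (auto simp: bounded_clinear_def)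
  have adj: "inner (A u) v = inner u (cadjoint A v)" "inner (cadjoint A u) v = inner u (A v)" for u v
    using inner_cadjoint[OF A] inner_commute by metis+
  have "cinner (app (T * B0) x) y = cinner (app (B0 * T) x) y" for y
  proof -
    obtain K where K: "0 < K" "\<And>u. norm (cinner u y) \<le> norm u * K"
      using bounded_linear.pos_bounded[OF bounded_linear_cinner_left] by blast
    show ?thesis
    proof (rule bounded_conjugation_imp_commute[where J = J and N = N and \<phi> = "\<lambda>X. cinner (app X x) y"
        and C = "norm B0 * norm x * K"])
      show "J * J = - 1" "J * T = T * J" "J * N = N * J" "J * B0 = B0 * J"
        by (rule eqI; simp add: app_simps app scalar scalar_simps i i_scaleC_twice)+
      show "T * N = N * T" "N * B0 = B0 * N"
        by (rule eqI; use normal AB in \<open>simp add: app_simps app scalar scalar_simps normal_op_def fun_eq_iff\<close>)+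
      show bl: "bounded_linear (\<lambda>X. cinner (app X x) y)"
        by (rule bounded_linear_compose[OF bounded_linear_cinner_left bounded_linear_app_left])
      show "cinner (app (J * X) x) y = \<i> * cinner (app X x) y" for X
        by (simp add: app_simps app cinner_scaleC_left)
      fix s t :: real
      define W where "W = s *\<^sub>R (T - N) + t *\<^sub>R (J * (T + N))"
      have "inner (\<i> *\<^sub>C (cadjoint A u + A u)) u = 0" for u
      proof -
        have "inner (\<i> *\<^sub>C (cadjoint A u + A u)) u = - inner u (\<i> *\<^sub>C (cadjoint A u + A u))"
          by (simp add: inner_i_skew adj inner_add_left inner_add_right scaleC_add_right i)
        then show ?thesis by (simp add: inner_commute)
      qed
      then have W: "inner (app W u) u = 0" for u
        using adj(2)[of u u] inner_commute[of u "A u"]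
        by (simp add: W_def app_simps app inner_add_left inner_diff_left)
      have "norm (cinner (app (exp W * B0 * exp (- W)) x) y) \<le> norm (app (exp W * B0 * exp (- W)) x) * K"
        by (rule K)
      also have "norm (app (exp W * B0 * exp (- W)) x) = norm (app B0 (app (exp (- W)) x))"
        by (simp add: app_simps skew_exp_isometry W)
      also have "\<dots> \<le> norm B0 * norm (app (exp (- W)) x)" by (rule norm_app_le)
      also have "norm (app (exp (- W)) x) = norm x"
        by (rule skew_exp_isometry) (simp add: app_simps W)
      finally show "norm (cinner (app (exp (s *\<^sub>R (T - N) + t *\<^sub>R (J * (T + N))) * B0 *
          exp (- (s *\<^sub>R (T - N) + t *\<^sub>R (J * (T + N))))) x) y) \<le> norm B0 * norm x * K"
        using K(1) by (simp add: W_def)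
    qed
  qed
  then have "cinner y (cadjoint A (B x)) = cinner y (B (cadjoint A x))" for y
    by (metis app_simps(7) app(2,4) cinner_commute)
  then show ?thesis by (rule cinner_eqI)
qed

section \<open>The triangle inequality for the modulus\<close>

theorem corollary3p6:
  fixes A B :: "'a::complex_hilbert_space \<Rightarrow> 'a"
  assumes "bounded_clinear A" and "bounded_clinear B"
    and "A \<circ> B = B \<circ> A"
    and "normal_op A" and "hyponormal_op B"
  shows "op_le (op_abs (\<lambda>x. A x - B x)) (\<lambda>x. op_abs A x + op_abs B x)"
proof -
  note A = assms(1) and B = assms(2)
  define A' B' a b where "A' = cadjoint A" and "B' = cadjoint B" and "a = op_abs A" and "b = op_abs B"
  have bl: "bounded_linear A" "bounded_linear B" "bounded_linear A'" "bounded_linear B'"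
    using A B bounded_clinear_cadjoint by (auto simp: A'_def B'_def bounded_clinear_def)
  have adj: "inner (A x) y = inner x (A' y)" "inner (A' x) y = inner x (A y)"
    "inner (B x) y = inner x (B' y)" "inner (B' x) y = inner x (B y)" for x y
    unfolding A'_def B'_def using inner_cadjoint[OF A] inner_cadjoint[OF B] inner_commute by metis+
  have eqI: "u = v" if "\<And>y. inner u y = inner v y" for u v :: 'a
    by (rule inner_eqI) (metis that inner_commute)
  have AB: "A (B x) = B (A x)" for x using assms(3) by (simp add: fun_eq_iff)
  have A'B: "A' (B x) = B (A' x)" for x unfolding A'_def by (rule fuglede) (use assms in auto)
  have AB': "A (B' x) = B' (A x)" and A'B': "A' (B' x) = B' (A' x)" for x
    by (rule eqI; simp add: adj AB A'B)+
  have normal: "norm (A' x) = norm (A x)" for x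
  proof -
    have "A (A' x) = A' (A x)" using assms(4) by (simp add: normal_op_def A'_def fun_eq_iff)
    then have "(norm (A' x))\<^sup>2 = (norm (A x))\<^sup>2" by (simp add: power2_norm_eq_inner adj)
    then show ?thesis by simp
  qed
  have hypo: "norm (B' x) \<le> norm (B x)" for x
  proof -
    have "0 \<le> inner (B' (B x) - B (B' x)) x"
      using assms(5) unfolding hyponormal_op_def op_le_def positive_op_iff real_positive_def B'_def comp_def
      by blast
    then have "(norm (B' x))\<^sup>2 \<le> (norm (B x))\<^sup>2" by (simp add: power2_norm_eq_inner inner_diff_left adj)
    then show ?thesis by (rule power2_le_imp_le) simp
  qed
  have a_pos: "real_positive a" and b_pos: "real_positive b"
    using positive_op_abs[OF A] positive_op_abs[OF B] by (simp_all add: a_def b_def positive_op_iff)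
  have a_norm: "norm (a x) = norm (A x)" and b_norm: "norm (b x) = norm (B x)" for x
    using norm_op_abs[OF A] norm_op_abs[OF B] by (simp_all add: a_def b_def)
  \<comment> \<open>\<open>A\<^sup>* A\<close> commutes with \<open>B\<close> and \<open>B\<^sup>*\<close>, hence so does its root \<open>a\<close>, hence \<open>a\<close> commutes with \<open>b\<close>.\<close>
  have a_comm: "B (a x) = a (B x)" "B' (a x) = a (B' x)" for x
    unfolding a_def
    by (rule op_abs_commute[OF A]; use bl in \<open>simp add: fun_eq_iff AB A'B AB' A'B' flip: A'_def\<close>)+
  have ab: "a (b x) = b (a x)" for x
    unfolding b_def
    by (rule op_abs_commute[OF B])
      (use a_pos in \<open>simp_all add: real_positive_def fun_eq_iff a_comm flip: B'_def\<close>)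
  have a: "bounded_linear a" "\<And>x y. inner (a x) y = inner x (a y)"
    and b: "bounded_linear b" "\<And>x y. inner (b x) y = inner x (b y)" "\<And>x. 0 \<le> inner (b x) x"
    using a_pos b_pos by (auto simp: real_positive_def)
  have ab_pos: "real_positive (\<lambda>x. a (b x))"
  proof -
    obtain r where r: "real_positive r" and rr: "\<And>x. r (r x) = a x"
      and comm: "\<And>c x. bounded_linear c \<Longrightarrow> c \<circ> a = a \<circ> c \<Longrightarrow> c (r x) = r (c x)"
      using real_positive_sqrt_exists[OF a_pos] by blast
    \<comment> \<open>A product of commuting positive operators is a congruence by the root of one factor.\<close>
    have "b (r x) = r (b x)" for x by (rule comm[OF b(1)]) (simp add: fun_eq_iff ab)
    then have "inner (a (b x)) x = inner (b (r x)) (r x)" for x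
      using r rr by (metis real_positive_def)
    then show ?thesis
      unfolding real_positive_def using b a by (auto intro: bounded_linear_compose simp: ab)
  qed
  have cross: "- inner (A x) (B x) \<le> inner (a x) (b x)" for x
  proof -
    \<comment> \<open>The real part of \<open>- A\<^sup>* B\<close>, whose square is to be compared with that of \<open>a b\<close>.\<close>
    define X where "X x = (- 1/2) *\<^sub>R (A' (B x) + B' (A x))" for x
    have "bounded_linear X" unfolding X_def
      by (intro bounded_linear_intros bounded_linear_compose[OF bl(3) bl(2)] bounded_linear_compose[OF bl(4) bl(1)])
    moreover have "inner (X x) y = inner x (X y)" for x y
      by (simp add: X_def inner_add_left inner_add_right adj)
    moreover have "norm (X x) \<le> norm (a (b x))" for x
    proof -
      have abx: "norm (a (b x)) = norm (B (a x))" by (simp add: ab b_norm)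
      have "norm (A' (B x)) = norm (B (a x))" by (simp add: normal a_comm a_norm)
      \<comment> \<open>Trading \<open>A\<close> for \<open>a\<close> first lets hyponormality act on the outermost factor.\<close>
      moreover have "norm (B' (A x)) \<le> norm (B (a x))"
      proof -
        have "norm (B' (A x)) = norm (B' (a x))" by (simp add: a_comm a_norm flip: AB')
        then show ?thesis using hypo by simp
      qed
      ultimately have "norm (A' (B x) + B' (A x)) \<le> 2 * norm (a (b x))"
        using norm_triangle_ineq[of "A' (B x)" "B' (A x)"] abx by linarith
      then show ?thesis by (simp add: X_def)
    qed
    ultimately have "inner (X x) x \<le> inner (a (b x)) x"
      using norm_le_imp_inner_le[OF _ _ ab_pos] by blast
    moreover have "inner (X x) x = - inner (A x) (B x)"
      by (simp add: X_def inner_add_left adj(2,4) inner_commute[of "B x" "A x"])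
    moreover have "inner (a (b x)) x = inner (a x) (b x)" by (simp add: a inner_commute)
    ultimately show ?thesis by simp
  qed
  have diff: "bounded_clinear (\<lambda>x. A x - B x)" by (rule bounded_clinear_diff[OF A B])
  define d where "d = op_abs (\<lambda>x. A x - B x)"
  have d_pos: "positive_op d" unfolding d_def by (rule positive_op_abs[OF diff])
  have sum_real_pos: "real_positive (\<lambda>x. a x + b x)"
    using a_pos b_pos unfolding real_positive_def
    by (auto intro: bounded_linear_add simp: inner_add_left inner_add_right)
  have sum_pos: "positive_op (\<lambda>x. a x + b x)"
    unfolding positive_op_iff bounded_clinear_def
    using sum_real_pos positive_op_abs[OF A] positive_op_abs[OF B]
    by (auto simp: real_positive_def a_def b_def positive_op_iff bounded_clinear_def scaleC_add_right)
  have "op_le d (\<lambda>x. a x + b x)"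
  proof (rule op_leI[OF d_pos sum_pos], rule norm_le_imp_inner_le[OF _ _ sum_real_pos])
    show "bounded_linear d" "inner (d x) y = inner x (d y)" for x y
      using d_pos by (auto simp: positive_op_iff real_positive_def)
    fix x
    have square_diff: "(norm (A x - B x))\<^sup>2 = (norm (a x))\<^sup>2 + (norm (b x))\<^sup>2 - 2 * inner (A x) (B x)"
      unfolding a_norm b_norm
      by (simp add: power2_norm_eq_inner inner_diff_left inner_diff_right inner_commute)
    have square_sum: "(norm (a x + b x))\<^sup>2 = (norm (a x))\<^sup>2 + (norm (b x))\<^sup>2 + 2 * inner (a x) (b x)"
      by (simp add: power2_norm_eq_inner inner_add_left inner_add_right inner_commute)
    have "(norm (A x - B x))\<^sup>2 \<le> (norm (a x + b x))\<^sup>2"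
      using cross[of x] unfolding square_diff square_sum by simp
    then have "norm (A x - B x) \<le> norm (a x + b x)" by (rule power2_le_imp_le) simp
    then show "norm (d x) \<le> norm (a x + b x)" unfolding d_def norm_op_abs[OF diff] .
  qed
  then show ?thesis by (simp add: d_def a_def b_def)
qed

end
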